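(* Any equilibrium $\bar x=(\bar\varphi,\bar\omega,\bar b,\bar P_g,\bar\lambda)$ (with $\bar b\ge0$, $\bar P_g\ge0$) of the closed-loop system $$\begin{aligned} \dot\varphi&=D_t^T\omega\\ M\dot\omega&=-D_t\nabla U(\varphi)-A\omega+P_g-P_d\\ \tau_b\dot b&=[P_g-\nabla C^*(b)]^+_{b}\\ \tau_g\dot P_g&=[\mathbf 1\lambda-b+\rho\mathbf 1\mathbf 1^T(P_d-P_g)-\sigma^2\omega]^+_{P_g}\\ \tau_\lambda\dot\lambda&=\mathbf 1^T(P_d-P_g) \end{aligned}$$ is efficient; that is, $\bar\omega=0$, $\bar b$ is an efficient Nash equilibrium of the inelastic electricity market game, and $\bar P_g$ is a primal optimizer of the economic dispatch problem.
   Context: Vector inequalities are componentwise; $\mathbf 1$ is the all-ones vector of appropriate dimension. For scalars $a$ and $b\ge0$, $[a]^+_b=a$ if $b>0$ and $[a]^+_b=\max(a,0)$ if $b=0$; for vectors $[a]^+_b$ is defined componentwise. Network. $\mathcal G$ is a connected undirected graph with $n$ nodes (buses) and $m$ edges (lines), with arbitrarily chosen edge orientations and incidence matrix $D\in\mathbb R^{n\times m}$ ($D_{ik}=+1$ if $i$ is the positive end of edge $k$, $-1$ if $i$ is the negative end, $0$ otherwise). $\Gamma=\operatorname{diag}(\gamma_1,\dots,\gamma_m)$ with $\gamma_k=B_{ij}V_iV_j>0$ for the edge $k$ between nodes $i$ and $j$, where $B_{ij}=B_{ji}>0$ and $V_i>0$. $D_t\in\mathbb R^{n\times(n-1)}$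 is the incidence matrix of an arbitrary tree on the node set $\{1,\dots,n\}$, $D_t^\dagger=(D_t^TD_t)^{-1}D_t^T$, and $U(\varphi)=-\mathbf 1^T\Gamma\,\mathbf{cos}(D^T(D_t^\dagger)^T\varphi)$ for $\varphi\in\mathbb R^{n-1}$, where $\mathbf{cos}$ is the elementwise cosine. $M,A\in\mathbb R^{n\times n}$ are diagonal with positive diagonal entries. The states are $\varphi\in\mathbb R^{n-1}$, $\omega\in\mathbb R^n$, $b\in\mathbb R^n_{\ge0}$, $P_g\in\mathbb R^n_{\ge0}$, $\lambda\in\mathbb R$. The design parameters are $\rho,\sigma,\tau_\lambda>0$ and diagonal positive definite matrices $\tau_b,\tau_g\in\mathbb R^{n\times n}$. An equilibrium is a point of the state space at which the right-hand sides all vanish. Costs. For each $i\in\{1,\dots,n\}$, $C_i:\mathbb R_{\ge0}\to\mathbb R_{\ge0}$ is strongly convex on $\mathbb R_{\ge0}$ (twice continuously differentiable, with $\nabla^2C_i(x)>\mu_i$ for all $x\ge0$ and some constant $\mu_i>0$) and satisfies $\nabla C_i(0)\ge0$. Put $C(P_g)=\sum_iC_i(P_{gi})$. The load $P_d\in\mathbb R^n_{\ge0}$ satisfies $\mathbf 1^TP_d>0$. For $b_i\ge0$ the convex conjugate is $C_i^*(b_i)=\max_{P_{gi}\ge0}\{b_iP_{gi}-C_i(P_{gi})\}$, and $C^*(b)=\sum_iC_i^*(b_i)$; it is continuously differentiable with $\nabla C_i^*(b_i)=\operatorname{arg\,max}_{P_{gi}\ge0}\{b_iP_{gi}-C_i(P_{gi})\}$.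 Economic dispatch problem: minimize $C(P_g)$ subject to $\mathbf 1^TP_g=\mathbf 1^TP_d$ and $P_g\ge0$; it has a unique optimizer $P_g^*$. Standing assumptions: $P_{gi}^*>0$ for at least two distinct $i$; and for $P_g=P_g^*$ there exists an equilibrium $(\bar\varphi,\bar\omega)$ of $\dot\varphi=D_t^T\omega$, $M\dot\omega=-D_t\nabla U(\varphi)-A\omega+P_g-P_d$ with $D^T(D_t^\dagger)^T\bar\varphi\in(-\pi/2,\pi/2)^m$. Market game. Given $b\in\mathbb R^n_{\ge0}$, let $(\mathrm{LP}_b)$ be: minimize $b^TP_g$ subject to $\mathbf 1^TP_g=\mathbf 1^TP_d$, $P_g\ge0$; $P_g^{\rm opt}(b)$ denotes an optimizer (possibly non-unique). In the inelastic electricity market game the players are $\{1,\dots,n\}$, player $i$ chooses a bid $b_i\ge0$, and its payoff is $\Pi_i(b_i,P_{gi}^{\rm opt}(b))=P_{gi}^{\rm opt}(b)b_i-C_i(P_{gi}^{\rm opt}(b))$. A bid $b^*\in\mathbb R^n_{\ge0}$ is a Nash equilibrium if there exists an optimizer $P_g^{\rm opt}(b^* )$ of $(\mathrm{LP}_{b^*})$ such that for each $i$, $\Pi_i(b_i,P_{gi}^{\rm opt}(b_i,b_{-i}^* ))\le\Pi_i(b_i^*,P_{gi}^{\rm opt}(b^* ))$ for all $b_i\ge0$ with $b_i\neq b_i^*$ and all optimizers $P_g^{\rm opt}(b_i,b_{-i}^* )$ of the linear problem with bids $(b_i,b_{-i}^* )$, where $b_{-i}^*$ denotes the bids of all players except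 $i$. A bid $b^*$ is an efficient bid if $P_g^*$ is an optimizer of $(\mathrm{LP}_{b^*})$ and $P_{gi}^*=\operatorname{arg\,max}_{P_{gi}\ge0}\{P_{gi}b_i^*-C_i(P_{gi})\}$ for each $i$. An efficient Nash equilibrium is a bid that is both an efficient bid and a Nash equilibrium. *)

theory Defs
  imports "HOL-Analysis.Analysis" "Graph_Theory.Graph_Theory"
begin

section \<open>Graphs\<close>

text \<open>
  A simple undirected graph with a chosen orientation of its edges is a digraph in which every
  edge occurs in exactly one of its two orientations. Nodes and edges are the elements of the
  types \<open>'n\<close> and \<open>'e\<close>; the head of an arc is its positive end.
\<close>

definition oriented_graph :: "('n::finite, 'e::finite) pre_digraph \<Rightarrow> bool" where
  "oriented_graph G \<longleftrightarrow> verts G = UNIV \<and> arcs G = UNIV \<and> digraph G \<and>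
     (\<forall>k l. \<not> (tail G k = head G l \<and> head G k = tail G l))"

text \<open>
  The library predicate \<^const>\<open>Digraph_Component.tree\<close> only excludes directed cycles. An undirected
  cycle is a directed cycle of length at least three in the symmetric closure (the symmetric closure
  of a single edge is a directed cycle of length two).
\<close>

definition undirected_tree :: "('n::finite, 'e::finite) pre_digraph \<Rightarrow> bool" where
  "undirected_tree T \<longleftrightarrow> oriented_graph T \<and> Digraph_Component.connected T \<and>
     \<not> (\<exists>p. pre_digraph.cycle (with_proj (mk_symmetric T)) p \<and> 3 \<le> length p)"

definition incidence_matrix :: "('n::finite, 'e::finite) pre_digraph \<Rightarrow> real ^ 'e ^ 'n" where
  "incidence_matrix G =
     (\<chi> i k. if i = head G k then 1 else if i = tail G k then - 1 else 0)"

section \<open>Vectors and matrices\<close>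

definition diag_matrix :: "real ^ 'k \<Rightarrow> real ^ 'k ^ 'k" where
  "diag_matrix v = (\<chi> i j. if i = j then v $ i else 0)"

definition pos_diagonal :: "real ^ 'k ^ 'k \<Rightarrow> bool" where
  "pos_diagonal A \<longleftrightarrow> (\<forall>i j. i \<noteq> j \<longrightarrow> A $ i $ j = 0) \<and> (\<forall>i. 0 < A $ i $ i)"

definition left_pseudo_inverse :: "real ^ 't ^ 'n \<Rightarrow> real ^ 'n ^ 't" where
  "left_pseudo_inverse A = matrix_inv (transpose A ** A) ** transpose A"

definition cos_vec :: "real ^ 'k \<Rightarrow> real ^ 'k" where
  "cos_vec x = (\<chi> k. cos (x $ k))"

text \<open>The projection $[a]^+_b$, used for \<open>b \<ge> 0\<close> only.\<close>

definition proj_pos :: "real \<Rightarrow> real \<Rightarrow> real" where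
  "proj_pos a b = (if 0 < b then a else max a 0)"

definition proj_pos_vec :: "real ^ 'k \<Rightarrow> real ^ 'k \<Rightarrow> real ^ 'k" where
  "proj_pos_vec a b = (\<chi> i. proj_pos (a $ i) (b $ i))"

text \<open>
  Gradient of a function with domain \<open>S\<close>. It is used for \<open>S = UNIV\<close> and for the nonnegative
  orthant, where a gradient is unique also at boundary points.
\<close>

definition gradient_on :: "'a::euclidean_space set \<Rightarrow> ('a \<Rightarrow> real) \<Rightarrow> 'a \<Rightarrow> 'a" where
  "gradient_on S f x = (THE D. (f has_derivative (\<lambda>h. h \<bullet> D)) (at x within S))"

section \<open>Costs and economic dispatch\<close>

definition cost_function :: "(real \<Rightarrow> real) \<Rightarrow> bool" where
  "cost_function C \<longleftrightarrow> (\<forall>x\<ge>0. 0 \<le> C x) \<and>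
     (\<exists>C' C''. (\<forall>x\<ge>0. (C has_real_derivative C' x) (at x within {0..})) \<and>
               (\<forall>x\<ge>0. (C' has_real_derivative C'' x) (at x within {0..})) \<and>
               continuous_on {0..} C'' \<and>
               (\<exists>\<mu>>0. \<forall>x\<ge>0. \<mu> < C'' x) \<and>
               0 \<le> C' 0)"

definition total_cost :: "('n::finite \<Rightarrow> real \<Rightarrow> real) \<Rightarrow> real ^ 'n \<Rightarrow> real" where
  "total_cost C Pg = (\<Sum>i\<in>UNIV. C i (Pg $ i))"

text \<open>For a \<^const>\<open>cost_function\<close> the supremum is a maximum.\<close>

definition conjugate :: "(real \<Rightarrow> real) \<Rightarrow> real \<Rightarrow> real" where
  "conjugate C \<beta> = (SUP p\<in>{0..}. \<beta> * p - C p)"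

definition total_conjugate :: "('n::finite \<Rightarrow> real \<Rightarrow> real) \<Rightarrow> real ^ 'n \<Rightarrow> real" where
  "total_conjugate C b = (\<Sum>i\<in>UNIV. conjugate (C i) (b $ i))"

definition feasible_dispatch :: "real ^ 'n \<Rightarrow> real ^ 'n \<Rightarrow> bool" where
  "feasible_dispatch Pd Pg \<longleftrightarrow> 1 \<bullet> Pg = 1 \<bullet> Pd \<and> 0 \<le> Pg"

definition dispatch_optimizer ::
    "('n::finite \<Rightarrow> real \<Rightarrow> real) \<Rightarrow> real ^ 'n \<Rightarrow> real ^ 'n \<Rightarrow> bool" where
  "dispatch_optimizer C Pd Pg \<longleftrightarrow> is_arg_min (total_cost C) (feasible_dispatch Pd) Pg"

section \<open>The market game\<close>

definition LP_optimizer :: "real ^ 'n \<Rightarrow> real ^ 'n \<Rightarrow> real ^ 'n \<Rightarrow> bool" where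
  "LP_optimizer Pd b Pg \<longleftrightarrow> is_arg_min (\<lambda>P. b \<bullet> P) (feasible_dispatch Pd) Pg"

definition payoff :: "(real \<Rightarrow> real) \<Rightarrow> real \<Rightarrow> real \<Rightarrow> real" where
  "payoff C \<beta> p = p * \<beta> - C p"

definition deviate :: "real ^ 'n \<Rightarrow> 'n \<Rightarrow> real \<Rightarrow> real ^ 'n" where
  "deviate b i \<beta> = (\<chi> j. if j = i then \<beta> else b $ j)"

definition nash_equilibrium ::
    "('n::finite \<Rightarrow> real \<Rightarrow> real) \<Rightarrow> real ^ 'n \<Rightarrow> real ^ 'n \<Rightarrow> bool" where
  "nash_equilibrium C Pd b \<longleftrightarrow> 0 \<le> b \<and>
     (\<exists>P. LP_optimizer Pd b P \<and>
        (\<forall>i. \<forall>\<beta>\<ge>0. \<beta> \<noteq> b $ i \<longrightarrow>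
           (\<forall>Q. LP_optimizer Pd (deviate b i \<beta>) Q \<longrightarrow>
              payoff (C i) \<beta> (Q $ i) \<le> payoff (C i) (b $ i) (P $ i))))"

text \<open>Here \<open>Pstar\<close> is the economic dispatch optimizer.\<close>

definition efficient_bid ::
    "('n::finite \<Rightarrow> real \<Rightarrow> real) \<Rightarrow> real ^ 'n \<Rightarrow> real ^ 'n \<Rightarrow> real ^ 'n \<Rightarrow> bool" where
  "efficient_bid C Pd Pstar b \<longleftrightarrow> 0 \<le> b \<and> LP_optimizer Pd b Pstar \<and>
     (\<forall>i. {p. is_arg_max (\<lambda>q. q * b $ i - C i q) (\<lambda>q. 0 \<le> q) p} = {Pstar $ i})"

definition efficient_nash_equilibrium ::
    "('n::finite \<Rightarrow> real \<Rightarrow> real) \<Rightarrow> real ^ 'n \<Rightarrow> real ^ 'n \<Rightarrow> real ^ 'n \<Rightarrow> bool" where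
  "efficient_nash_equilibrium C Pd Pstar b \<longleftrightarrow>
     efficient_bid C Pd Pstar b \<and> nash_equilibrium C Pd b"

section \<open>Network dynamics\<close>

definition angle_differences :: "real ^ 'm ^ 'n \<Rightarrow> real ^ 't ^ 'n \<Rightarrow> real ^ 't \<Rightarrow> real ^ 'm" where
  "angle_differences D Dt \<phi> = transpose D *v (transpose (left_pseudo_inverse Dt) *v \<phi>)"

definition potential ::
    "real ^ 'm ^ 'n \<Rightarrow> real ^ 'm ^ 'm \<Rightarrow> real ^ 't ^ 'n \<Rightarrow> real ^ 't \<Rightarrow> real" where
  "potential D \<Gamma> Dt \<phi> = - (1 \<bullet> (\<Gamma> *v cos_vec (angle_differences D Dt \<phi>)))"

text \<open>
  The systems below are relations between a state and its velocity (the arguments prefixed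
  with \<open>d\<close>). At an equilibrium the velocity is zero, so the right-hand sides vanish.
\<close>

definition swing_system ::
    "real ^ 'm ^ 'n \<Rightarrow> real ^ 'm ^ 'm \<Rightarrow> real ^ 't ^ 'n \<Rightarrow> real ^ 'n ^ 'n \<Rightarrow> real ^ 'n ^ 'n \<Rightarrow>
     real ^ 'n \<Rightarrow> real ^ 'n \<Rightarrow>
     real ^ 't \<Rightarrow> real ^ 'n \<Rightarrow> real ^ 't \<Rightarrow> real ^ 'n \<Rightarrow> bool" where
  "swing_system D \<Gamma> Dt M A Pd Pg \<phi> \<omega> d\<phi> d\<omega> \<longleftrightarrow>
     d\<phi> = transpose Dt *v \<omega> \<and>
     M *v d\<omega> = - (Dt *v gradient_on UNIV (potential D \<Gamma> Dt) \<phi>) - A *v \<omega> + Pg - Pd"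

definition closed_loop_system ::
    "real ^ 'm ^ 'n \<Rightarrow> real ^ 'm ^ 'm \<Rightarrow> real ^ 't ^ 'n \<Rightarrow> real ^ 'n ^ 'n \<Rightarrow> real ^ 'n ^ 'n \<Rightarrow>
     real ^ 'n \<Rightarrow> ('n::finite \<Rightarrow> real \<Rightarrow> real) \<Rightarrow>
     real \<Rightarrow> real \<Rightarrow> real ^ 'n ^ 'n \<Rightarrow> real ^ 'n ^ 'n \<Rightarrow> real \<Rightarrow>
     real ^ 't \<Rightarrow> real ^ 'n \<Rightarrow> real ^ 'n \<Rightarrow> real ^ 'n \<Rightarrow> real \<Rightarrow>
     real ^ 't \<Rightarrow> real ^ 'n \<Rightarrow> real ^ 'n \<Rightarrow> real ^ 'n \<Rightarrow> real \<Rightarrow> bool" where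
  "closed_loop_system D \<Gamma> Dt M A Pd C \<rho> \<sigma> \<tau>b \<tau>g \<tau>l \<phi> \<omega> b Pg l d\<phi> d\<omega> db dPg dl \<longleftrightarrow>
     swing_system D \<Gamma> Dt M A Pd Pg \<phi> \<omega> d\<phi> d\<omega> \<and>
     \<tau>b *v db = proj_pos_vec (Pg - gradient_on {x. 0 \<le> x} (total_conjugate C) b) b \<and>
     \<tau>g *v dPg =
       proj_pos_vec (l *\<^sub>R 1 - b + (\<rho> * (1 \<bullet> (Pd - Pg))) *\<^sub>R 1 - \<sigma>\<^sup>2 *\<^sub>R \<omega>) Pg \<and>
     \<tau>l * dl = 1 \<bullet> (Pd - Pg)"

definition closed_loop_equilibrium ::
    "real ^ 'm ^ 'n \<Rightarrow> real ^ 'm ^ 'm \<Rightarrow> real ^ 't ^ 'n \<Rightarrow> real ^ 'n ^ 'n \<Rightarrow> real ^ 'n ^ 'n \<Rightarrow>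
     real ^ 'n \<Rightarrow> ('n::finite \<Rightarrow> real \<Rightarrow> real) \<Rightarrow>
     real \<Rightarrow> real \<Rightarrow> real ^ 'n ^ 'n \<Rightarrow> real ^ 'n ^ 'n \<Rightarrow> real \<Rightarrow>
     real ^ 't \<Rightarrow> real ^ 'n \<Rightarrow> real ^ 'n \<Rightarrow> real ^ 'n \<Rightarrow> real \<Rightarrow> bool" where
  "closed_loop_equilibrium D \<Gamma> Dt M A Pd C \<rho> \<sigma> \<tau>b \<tau>g \<tau>l \<phi> \<omega> b Pg l \<longleftrightarrow>
     0 \<le> b \<and> 0 \<le> Pg \<and>
     closed_loop_system D \<Gamma> Dt M A Pd C \<rho> \<sigma> \<tau>b \<tau>g \<tau>l \<phi> \<omega> b Pg l 0 0 0 0 0"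

end

theory Submission
  imports Defs
begin

text \<open>
  At an equilibrium the angle equation makes \<open>\<omega>\<close> constant along every edge of the connected
  tree, hence a multiple of the all-ones vector. Summing the swing equation over all nodes removes
  the flow term, and the integrator for \<open>l\<close> removes the power imbalance; what is left is a positive
  multiple of that constant, so \<open>\<omega> = 0\<close>.

  The rest is a statement about prices. The maximiser of \<open>\<beta> * p - C p\<close> over \<open>p \<ge> 0\<close> is the quantity
  a producer with cost \<open>C\<close> would sell at price \<open>\<beta>\<close>; strong convexity of \<open>C\<close> makes it a Lipschitz
  function of \<open>\<beta>\<close>, and therefore the gradient of the conjugate (\<open>conjugate_has_derivative\<close>). The bid
  equation then says that each producer generates what maximises its profit at its own bid; at a zero
  bid, where the projection only gives an upper bound, that quantity is zero because costs are
  increasing. The generation equation says that \<open>l\<close> is a market price: no bid is below it, and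
  whoever produces bids exactly \<open>l\<close>. These are the optimality conditions of the dispatch problem and
  of the linear problem of the operator, with multiplier \<open>l\<close>; the quadratic term coming from strong
  convexity also makes the optimal dispatch unique, so the equilibrium dispatch is \<open>Pstar\<close>.

  For the Nash property, a producer that bids above \<open>l\<close> sells nothing, because some other producer
  still bids \<open>l\<close>: this is where two producers are required. A producer that bids at most \<open>l\<close>
  receives at most the price \<open>l\<close>, which does not exceed its equilibrium bid, and at that bid its
  profit was already maximal.
\<close>

section \<open>Supply functions and conjugates\<close>

text \<open>
  The quadratic term records strong convexity: it yields uniqueness of the maximiser, its Lipschitz
  dependence on \<open>\<beta>\<close> and uniqueness of the dispatch. The normalisation at price zero expresses that
  the cost is increasing.
\<close>

definition supply_function :: "(real \<Rightarrow> real) \<Rightarrow> real \<Rightarrow> (real \<Rightarrow> real) \<Rightarrow> bool" where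
  "supply_function C \<mu> s \<longleftrightarrow> 0 < \<mu> \<and> s 0 = 0 \<and>
     (\<forall>\<beta>. 0 \<le> s \<beta> \<and> (\<forall>q\<ge>0. \<beta> * q - C q + \<mu> / 2 * (q - s \<beta>)\<^sup>2 \<le> \<beta> * s \<beta> - C (s \<beta>)))"

lemma supply_functionD:
  assumes "supply_function C \<mu> s"
  shows "0 < \<mu>" "s 0 = 0" "0 \<le> s \<beta>"
    "0 \<le> q \<Longrightarrow> \<beta> * q - C q + \<mu> / 2 * (q - s \<beta>)\<^sup>2 \<le> \<beta> * s \<beta> - C (s \<beta>)"
  using assms by (simp_all add: supply_function_def)

lemma supply_function_maximal:
  assumes "supply_function C \<mu> s" "0 \<le> q"
  shows "\<beta> * q - C q \<le> \<beta> * s \<beta> - C (s \<beta>)"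
proof -
  have "0 \<le> \<mu> / 2 * (q - s \<beta>)\<^sup>2"
    using supply_functionD(1)[OF assms(1)] by simp
  then show ?thesis
    using supply_functionD(4)[OF assms, of \<beta>] by linarith
qed

text \<open>
  The mean value theorem is applied twice, with derivatives relative to the half-line, so that the
  boundary point zero is covered as well.
\<close>

lemma strongly_convex_above_tangent:
  fixes C C' C'' :: "real \<Rightarrow> real"
  assumes C': "\<And>x. 0 \<le> x \<Longrightarrow> (C has_real_derivative C' x) (at x within {0..})"
    and C'': "\<And>x. 0 \<le> x \<Longrightarrow> (C' has_real_derivative C'' x) (at x within {0..})"
    and \<mu>: "\<And>x. 0 \<le> x \<Longrightarrow> \<mu> \<le> C'' x"
    and "0 \<le> p" "0 \<le> q"
  shows "C p + C' p * (q - p) + \<mu> / 2 * (q - p)\<^sup>2 \<le> C q"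
proof -
  have slope: "\<mu> * (y - x) \<le> C' y - C' x" if "0 \<le> x" "x < y" for x y
  proof -
    have "\<exists>z\<in>{x<..<y}. C' y - C' x = C'' z * (y - x)"
      using that
      by (intro mvt_simple[where f' = "\<lambda>z h. C'' z * h"])
        (auto intro!: has_derivative_subset[OF C''[unfolded has_field_derivative_def]])
    then obtain z where "x < z" "C' y - C' x = C'' z * (y - x)"
      by auto
    then show ?thesis
      using mult_right_mono[OF \<mu>, of z "y - x"] that by simp
  qed
  define h where "h y = C y - C' p * (y - p) - \<mu> / 2 * (y - p)\<^sup>2" for y
  have deriv: "(h has_derivative (\<lambda>d. (C' y - C' p - \<mu> * (y - p)) * d)) (at y within {0..})"
    if "0 \<le> y" for y
  proof -
    have "(h has_real_derivative C' y - C' p - \<mu> * (y - p)) (at y within {0..})"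
      unfolding h_def
      by (rule derivative_eq_intros C'[OF that] refl)+ (simp add: algebra_simps)
    then show ?thesis
      by (simp add: has_field_derivative_def)
  qed
  have mvt: "\<exists>z\<in>{x<..<y}. h y - h x = (C' z - C' p - \<mu> * (z - p)) * (y - x)"
    if "0 \<le> x" "x < y" for x y
    using that
    by (intro mvt_simple[where f' = "\<lambda>z d. (C' z - C' p - \<mu> * (z - p)) * d"])
      (auto intro!: has_derivative_subset[OF deriv])
  consider "q = p" | "p < q" | "q < p"
    by linarith
  then have "h p \<le> h q"
  proof cases
    case 2
    from mvt[OF \<open>0 \<le> p\<close> 2] obtain z where z: "p < z"
      "h q - h p = (C' z - C' p - \<mu> * (z - p)) * (q - p)"
      by auto
    have "0 \<le> (C' z - C' p - \<mu> * (z - p)) * (q - p)"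
      using slope[OF \<open>0 \<le> p\<close> z(1)] 2 by (intro mult_nonneg_nonneg) auto
    with z show ?thesis by linarith
  next
    case 3
    from mvt[OF \<open>0 \<le> q\<close> 3] obtain z where z: "q < z" "z < p"
      "h p - h q = (C' z - C' p - \<mu> * (z - p)) * (p - q)"
      by auto
    have "(C' z - C' p - \<mu> * (z - p)) * (p - q) \<le> 0"
      using slope[of z p] z(1,2) \<open>0 \<le> q\<close> 3
      by (intro mult_nonpos_nonneg) (auto simp: algebra_simps)
    with z show ?thesis by linarith
  qed simp
  then show ?thesis
    by (simp add: h_def)
qed

text \<open>
  If the marginal cost at zero already reaches \<open>\<beta>\<close>, nothing is supplied. Otherwise the marginal
  cost grows at least linearly and so takes the value \<open>\<beta>\<close> somewhere. In both cases the tangent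
  inequality at that point is the required estimate.
\<close>

lemma cost_function_supply:
  assumes "cost_function C"
  obtains \<mu> s where "supply_function C \<mu> s"
proof -
  from assms[unfolded cost_function_def, THEN conjunct2] obtain C' C'' where C:
    "(\<forall>x\<ge>0. (C has_real_derivative C' x) (at x within {0..})) \<and>
     (\<forall>x\<ge>0. (C' has_real_derivative C'' x) (at x within {0..})) \<and>
     continuous_on {0..} C'' \<and> (\<exists>\<mu>>0. \<forall>x\<ge>0. \<mu> < C'' x) \<and> 0 \<le> C' 0"
    by (elim exE) (rule that)
  then have C': "\<And>x. 0 \<le> x \<Longrightarrow> (C has_real_derivative C' x) (at x within {0..})"
    and C'': "\<And>x. 0 \<le> x \<Longrightarrow> (C' has_real_derivative C'' x) (at x within {0..})"
    and C'0: "0 \<le> C' 0"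
    by simp_all
  from C obtain \<mu> where \<mu>: "0 < \<mu>" "\<And>x. 0 \<le> x \<Longrightarrow> \<mu> < C'' x"
    by auto
  have tangent: "C p + C' p * (q - p) + \<mu> / 2 * (q - p)\<^sup>2 \<le> C q" if "0 \<le> p" "0 \<le> q" for p q
    by (rule strongly_convex_above_tangent[where C'' = C''])
      (use C' C'' \<mu>(2) that in \<open>auto intro: less_imp_le\<close>)
  have cont: "continuous_on {0..} C'"
    using C'' by (intro DERIV_continuous_on) simp
  have "\<exists>p\<ge>0. (\<beta> \<le> C' 0 \<longrightarrow> p = 0) \<and>
      (\<forall>q\<ge>0. \<beta> * q - C q + \<mu> / 2 * (q - p)\<^sup>2 \<le> \<beta> * p - C p)" for \<beta>
  proof (cases "\<beta> \<le> C' 0")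
    case True
    have "\<beta> * q - C q + \<mu> / 2 * q\<^sup>2 \<le> - C 0" if "0 \<le> q" for q
      using tangent[of 0 q] that mult_right_mono[OF True that] by simp
    then show ?thesis by (intro exI[of _ 0]) simp
  next
    case False
    define x where "x = (\<beta> - C' 0) / \<mu>"
    have "0 < x"
      using False \<mu>(1) by (simp add: x_def)
    have "\<exists>z\<in>{0<..<x}. C' x - C' 0 = C'' z * (x - 0)"
      using \<open>0 < x\<close>
      by (intro mvt_simple[where f' = "\<lambda>z h. C'' z * h"])
        (auto intro!: has_derivative_subset[OF C''[unfolded has_field_derivative_def]])
    then obtain z where "0 < z" "C' x - C' 0 = C'' z * x"
      by auto
    moreover have "\<mu> * x = \<beta> - C' 0"
      using \<mu>(1) by (simp add: x_def)
    ultimately have "\<beta> \<le> C' x"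
      using mult_right_mono[of \<mu> "C'' z" x] \<mu>(2)[of z] \<open>0 < x\<close> by simp
    moreover have "continuous_on {0..x} C'"
      by (rule continuous_on_subset[OF cont]) auto
    ultimately obtain p where "0 \<le> p" "C' p = \<beta>"
      using IVT'[of C' 0 \<beta> x] False \<open>0 < x\<close> by auto
    have "\<beta> * q - C q + \<mu> / 2 * (q - p)\<^sup>2 \<le> \<beta> * p - C p" if "0 \<le> q" for q
      using tangent[OF \<open>0 \<le> p\<close> that] \<open>C' p = \<beta>\<close> by (simp add: algebra_simps)
    then show ?thesis
      using \<open>0 \<le> p\<close> False by blast
  qed
  then obtain s where s: "\<And>\<beta>. 0 \<le> s \<beta>" "\<And>\<beta>. \<beta> \<le> C' 0 \<Longrightarrow> s \<beta> = 0"
    "\<And>\<beta> q. 0 \<le> q \<Longrightarrow> \<beta> * q - C q + \<mu> / 2 * (q - s \<beta>)\<^sup>2 \<le> \<beta> * s \<beta> - C (s \<beta>)"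
    by metis
  then have "supply_function C \<mu> s"
    using \<mu>(1) C'0 unfolding supply_function_def by auto
  then show thesis by (rule that)
qed

lemma conjugate_eq_supply:
  assumes "supply_function C \<mu> s"
  shows "conjugate C \<beta> = \<beta> * s \<beta> - C (s \<beta>)"
  unfolding conjugate_def
  using supply_functionD(3)[OF assms, of \<beta>] supply_function_maximal[OF assms, of _ \<beta>]
  by (intro cSup_eq_maximum) auto

lemma supply_argmax:
  assumes "supply_function C \<mu> s"
  shows "{p. is_arg_max (\<lambda>q. q * \<beta> - C q) (\<lambda>q. 0 \<le> q) p} = {s \<beta>}"
proof (intro equalityI subsetI)
  fix p assume "p \<in> {p. is_arg_max (\<lambda>q. q * \<beta> - C q) (\<lambda>q. 0 \<le> q) p}"
  then have p: "0 \<le> p" "\<beta> * s \<beta> - C (s \<beta>) \<le> \<beta> * p - C p"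
    using supply_functionD(3)[OF assms, of \<beta>]
    by (auto simp: is_arg_max_def not_less mult.commute)
  then have "\<mu> / 2 * (p - s \<beta>)\<^sup>2 \<le> 0"
    using supply_functionD(4)[OF assms, of p \<beta>] by linarith
  then show "p \<in> {s \<beta>}"
    using supply_functionD(1)[OF assms] by (simp add: mult_le_0_iff)
next
  fix p assume "p \<in> {s \<beta>}"
  then show "p \<in> {p. is_arg_max (\<lambda>q. q * \<beta> - C q) (\<lambda>q. 0 \<le> q) p}"
    using supply_functionD(3)[OF assms, of \<beta>] supply_function_maximal[OF assms, of _ \<beta>]
    by (auto simp: is_arg_max_def not_less mult.commute)
qed

text \<open>Each of the two maximisers is a competitor of the other; adding the two estimates bounds the
  square of their distance.\<close>

lemma supply_Lipschitz:
  assumes "supply_function C \<mu> s"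
  shows "\<mu> * \<bar>s \<alpha> - s \<beta>\<bar> \<le> \<bar>\<alpha> - \<beta>\<bar>"
proof (cases "s \<alpha> = s \<beta>")
  case False
  have "\<mu> * (s \<alpha> - s \<beta>)\<^sup>2 \<le> (\<alpha> - \<beta>) * (s \<alpha> - s \<beta>)"
    using supply_functionD(4)[OF assms, of "s \<alpha>" \<beta>] supply_functionD(4)[OF assms, of "s \<beta>" \<alpha>]
      supply_functionD(3)[OF assms]
    by (simp add: power2_commute[of "s \<beta>"] algebra_simps)
  also have "\<dots> \<le> \<bar>\<alpha> - \<beta>\<bar> * \<bar>s \<alpha> - s \<beta>\<bar>"
    by (metis abs_ge_self abs_mult)
  finally have "(\<mu> * \<bar>s \<alpha> - s \<beta>\<bar>) * \<bar>s \<alpha> - s \<beta>\<bar> \<le> \<bar>\<alpha> - \<beta>\<bar> * \<bar>s \<alpha> - s \<beta>\<bar>"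
    by (simp add: power2_eq_square mult.assoc)
  then show ?thesis
    using False by simp
qed simp

text \<open>
  Keeping the old quantity at the new price, and the new quantity at the old price, sandwiches the
  difference quotient of the conjugate between the supplies at the two prices.
\<close>

lemma conjugate_has_derivative:
  assumes "supply_function C \<mu> s"
  shows "(conjugate C has_real_derivative s \<beta>) (at \<beta> within S)"
proof -
  note \<mu> = supply_functionD(1)[OF assms]
  have quotient: "\<bar>(conjugate C y - conjugate C \<beta>) / (y - \<beta>) - s \<beta>\<bar> \<le> \<bar>y - \<beta>\<bar> / \<mu>"
    if "y \<noteq> \<beta>" for y
  proof -
    have "(y - \<beta>) * s \<beta> \<le> conjugate C y - conjugate C \<beta>"
      "conjugate C y - conjugate C \<beta> \<le> (y - \<beta>) * s y"
      using supply_function_maximal[OF assms, of "s \<beta>" y]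
        supply_function_maximal[OF assms, of "s y" \<beta>] supply_functionD(3)[OF assms]
      by (simp_all add: conjugate_eq_supply[OF assms] algebra_simps)
    then have "\<bar>conjugate C y - conjugate C \<beta> - (y - \<beta>) * s \<beta>\<bar> \<le> \<bar>(y - \<beta>) * (s y - s \<beta>)\<bar>"
      by (simp add: algebra_simps)
    also have "\<dots> \<le> \<bar>y - \<beta>\<bar> * (\<bar>y - \<beta>\<bar> / \<mu>)"
      unfolding abs_mult
      using supply_Lipschitz[OF assms, of y \<beta>] \<mu>
      by (intro mult_left_mono) (simp_all add: pos_le_divide_eq mult.commute)
    finally have "\<bar>conjugate C y - conjugate C \<beta> - (y - \<beta>) * s \<beta>\<bar> / \<bar>y - \<beta>\<bar> \<le> \<bar>y - \<beta>\<bar> / \<mu>"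
      using that by (simp add: pos_divide_le_eq mult.commute)
    moreover have "(conjugate C y - conjugate C \<beta>) / (y - \<beta>) - s \<beta> =
        (conjugate C y - conjugate C \<beta> - (y - \<beta>) * s \<beta>) / (y - \<beta>)"
      using that by (simp add: field_simps)
    ultimately show ?thesis
      by (simp only: abs_divide)
  qed
  have "((\<lambda>y. \<bar>y - \<beta>\<bar> / \<mu>) \<longlongrightarrow> \<bar>\<beta> - \<beta>\<bar> / \<mu>) (at \<beta> within S)"
    by (intro tendsto_intros) (use \<mu> in auto)
  then have "((\<lambda>y. \<bar>y - \<beta>\<bar> / \<mu>) \<longlongrightarrow> 0) (at \<beta> within S)"
    by simp
  then have "((\<lambda>y. (conjugate C y - conjugate C \<beta>) / (y - \<beta>) - s \<beta>) \<longlongrightarrow> 0) (at \<beta> within S)"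
    by (rule Lim_null_comparison[rotated])
      (use quotient in \<open>auto simp: eventually_at_filter\<close>)
  then show ?thesis
    by (simp add: has_field_derivative_iff Lim_null[symmetric])
qed

text \<open>
  Every point of the orthant has room inside the orthant in each coordinate direction, so that
  one-sided derivatives determine the gradient.
\<close>

lemma gradient_on_orthant_eq:
  fixes f :: "real ^ 'n::finite \<Rightarrow> real"
  assumes "0 \<le> x" and D: "(f has_derivative (\<lambda>h. h \<bullet> D)) (at x within {x. 0 \<le> x})"
  shows "gradient_on {x. 0 \<le> x} f x = D"
  unfolding gradient_on_def
proof (rule the_equality)
  fix E assume E: "(f has_derivative (\<lambda>h. h \<bullet> E)) (at x within {x. 0 \<le> x})"
  have "(\<lambda>h. h \<bullet> E) = (\<lambda>h. h \<bullet> D)"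
  proof (rule frechet_derivative_unique_within[OF E D])
    fix i :: "real ^ 'n" and e :: real
    assume "i \<in> Basis" "0 < e"
    then have "0 \<le> x + (e / 2) *\<^sub>R i"
      using \<open>0 \<le> x\<close> by (auto simp: less_eq_vec_def Basis_vec_def axis_def)
    then show "\<exists>d. 0 < \<bar>d\<bar> \<and> \<bar>d\<bar> < e \<and> x + d *\<^sub>R i \<in> {x. 0 \<le> x}"
      using \<open>0 < e\<close> by (intro exI[of _ "e / 2"]) auto
  qed
  then show "E = D"
    by (metis vector_eq_rdot inner_commute)
qed (rule D)

lemma gradient_total_conjugate:
  assumes s: "\<And>i. supply_function (C i) (\<mu> i) (s i)" and "0 \<le> b"
  shows "gradient_on {x. 0 \<le> x} (total_conjugate C) b = (\<chi> i. s i (b $ i))"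
proof (rule gradient_on_orthant_eq[OF \<open>0 \<le> b\<close>])
  have "((\<lambda>x. conjugate (C i) (x $ i)) has_derivative (\<lambda>h. s i (b $ i) * h $ i))
      (at b within {x. 0 \<le> x})" for i
    using conjugate_has_derivative[OF s, unfolded has_field_derivative_def]
    by (rule has_derivative_in_compose[rotated])
      (rule bounded_linear_imp_has_derivative[OF bounded_linear_vec_nth])
  then have "(total_conjugate C has_derivative (\<lambda>h. \<Sum>i\<in>UNIV. s i (b $ i) * h $ i))
      (at b within {x. 0 \<le> x})"
    unfolding total_conjugate_def by (intro has_derivative_sum)
  then show "(total_conjugate C has_derivative (\<lambda>h. h \<bullet> (\<chi> i. s i (b $ i))))
      (at b within {x. 0 \<le> x})"
    by (simp add: inner_vec_def mult.commute)
qed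

section \<open>Frequency synchronization\<close>

lemma one_inner: "1 \<bullet> x = (\<Sum>i\<in>UNIV. x $ i)" for x :: "real ^ 'n::finite"
  by (simp add: inner_vec_def)

lemma vector_incidence_matrix:
  assumes "oriented_graph T"
  shows "(x v* incidence_matrix T) $ k = x $ head T k - x $ tail T k"
proof -
  have "digraph T" and arcs: "arcs T = UNIV"
    using assms by (auto simp: oriented_graph_def)
  then interpret digraph T by simp
  have "tail T k \<noteq> head T k"
    using no_loops arcs by auto
  then have "x $ i * incidence_matrix T $ i $ k =
      (if i = head T k then x $ i else 0) - (if i = tail T k then x $ i else 0)" for i
    by (auto simp: incidence_matrix_def)
  then show ?thesis
    by (simp add: vector_matrix_mult_def sum_subtractf)
qed

lemma incidence_kernel_constant:
  assumes "oriented_graph T" "Digraph_Component.connected T"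
    and x: "transpose (incidence_matrix T) *v x = 0"
  shows "x $ u = x $ v"
proof -
  have edge: "x $ head T k = x $ tail T k" for k
    using vector_incidence_matrix[OF assms(1), of x k] x by simp
  have "u \<rightarrow>\<^sup>*\<^bsub>with_proj (mk_symmetric T)\<^esub> v"
    using assms(1,2) by (simp add: connected_def strongly_connected_def oriented_graph_def)
  then show ?thesis
    unfolding reachable_def
  proof (induction rule: rtrancl_on_induct)
    case (step y z)
    then have "x $ y = x $ z"
      using edge by (auto simp: parcs_mk_symmetric)
    with step show ?case by simp
  qed simp
qed

text \<open>Balanced generation cannot sustain a common frequency deviation against the damping.\<close>

lemma balanced_swing_equilibrium:
  assumes T: "oriented_graph T" "Digraph_Component.connected T"
    and A: "pos_diagonal A" and balance: "1 \<bullet> Pg = 1 \<bullet> Pd"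
    and swing: "swing_system D \<Gamma> (incidence_matrix T) M A Pd Pg \<phi> \<omega> 0 0"
  shows "\<omega> = 0"
proof -
  let ?Dt = "incidence_matrix T"
  define g where "g = gradient_on UNIV (potential D \<Gamma> ?Dt) \<phi>"
  have kernel: "transpose ?Dt *v \<omega> = 0" and nodes: "0 = - (?Dt *v g) - A *v \<omega> + Pg - Pd"
    using swing by (simp_all add: swing_system_def g_def)
  note const = incidence_kernel_constant[OF T kernel]
  have "1 v* ?Dt = 0"
    by (simp add: vec_eq_iff vector_incidence_matrix[OF T(1)])
  then have "1 \<bullet> (?Dt *v g) = 0"
    by (simp add: dot_lmul_matrix[symmetric])
  moreover have "1 \<bullet> (- (?Dt *v g) - A *v \<omega> + Pg - Pd) = 0"
    by (simp only: nodes[symmetric] inner_zero_right)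
  ultimately have "1 \<bullet> (A *v \<omega>) = 0"
    using balance by (simp add: inner_diff_right inner_add_right)
  moreover have "(A *v \<omega>) $ i = A $ i $ i * \<omega> $ i" for i
  proof -
    have "(\<Sum>j\<in>UNIV. A $ i $ j * \<omega> $ j) =
        (\<Sum>j\<in>UNIV. if j = i then A $ i $ i * \<omega> $ i else 0)"
      using A by (intro sum.cong) (auto simp: pos_diagonal_def)
    then show ?thesis
      by (simp add: matrix_vector_mult_def)
  qed
  ultimately have total: "(\<Sum>i\<in>UNIV. A $ i $ i * \<omega> $ i) = 0"
    by (simp add: one_inner)
  have "(\<Sum>i\<in>UNIV. A $ i $ i) * \<omega> $ j = 0" for j
  proof -
    have "A $ i $ i * \<omega> $ j = A $ i $ i * \<omega> $ i" for i
      by (rule arg_cong[OF const])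
    then show ?thesis
      using total by (simp only: sum_distrib_right)
  qed
  moreover have "0 < (\<Sum>i\<in>UNIV. A $ i $ i)"
    using A by (intro sum_pos) (auto simp: pos_diagonal_def)
  ultimately show ?thesis
    by (simp add: vec_eq_iff)
qed

section \<open>Market prices\<close>

text \<open>Shifting the output of a node to a cheaper one would lower the cost.\<close>

lemma LP_optimizer_undercut:
  assumes "LP_optimizer Pd b Q" "b $ j < b $ i"
  shows "Q $ i = 0"
proof (rule ccontr)
  assume "Q $ i \<noteq> 0"
  have Q: "1 \<bullet> Q = 1 \<bullet> Pd" "\<And>k. 0 \<le> Q $ k"
    and opt: "\<And>P. feasible_dispatch Pd P \<Longrightarrow> b \<bullet> Q \<le> b \<bullet> P"
    using assms(1)
    by (auto simp: LP_optimizer_def is_arg_min_def feasible_dispatch_def less_eq_vec_def not_less)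
  have "0 < Q $ i"
    using \<open>Q $ i \<noteq> 0\<close> Q(2)[of i] by simp
  define P where "P = Q + Q $ i *\<^sub>R (axis j 1 - axis i 1)"
  have "feasible_dispatch Pd P"
    unfolding feasible_dispatch_def less_eq_vec_def
  proof (intro conjI allI)
    show "1 \<bullet> P = 1 \<bullet> Pd"
      using Q(1) by (simp add: P_def inner_add_right inner_diff_right inner_axis)
    show "0 $ k \<le> P $ k" for k
      using Q(2)[of k] Q(2)[of i] by (auto simp: P_def axis_def)
  qed
  from opt[OF this] have "0 \<le> Q $ i * (b $ j - b $ i)"
    by (simp add: P_def inner_add_right inner_diff_right inner_axis)
  with \<open>0 < Q $ i\<close> assms(2) show False
    by (simp add: zero_le_mult_iff)
qed

text \<open>Complementary slackness: \<open>l\<close> is the multiplier of the power balance.\<close>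

lemma LP_optimizer_market_price:
  assumes "feasible_dispatch Pd P"
    and price: "\<And>i. l \<le> b $ i" "\<And>i. 0 < P $ i \<Longrightarrow> b $ i = l"
  shows "LP_optimizer Pd b P"
proof -
  have "b \<bullet> P \<le> b \<bullet> Q" if "feasible_dispatch Pd Q" for Q
  proof -
    have "b $ i * P $ i = l * P $ i" for i
      using price(2)[of i] assms(1)
      by (cases "P $ i = 0") (auto simp: feasible_dispatch_def less_eq_vec_def order_less_le)
    then have "b \<bullet> P = l * (1 \<bullet> P)"
      by (simp only: inner_vec_def sum_distrib_left inner_real_def one_index mult_1)
    also have "\<dots> = l * (1 \<bullet> Q)"
      using assms(1) that by (simp add: feasible_dispatch_def)
    also have "\<dots> \<le> b \<bullet> Q"
    proof -
      have "0 \<le> Q $ i" for i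
        using that by (simp add: feasible_dispatch_def less_eq_vec_def)
      then show ?thesis
        using price(1) by (simp add: inner_vec_def sum_distrib_left sum_mono mult_right_mono)
    qed
    finally show ?thesis .
  qed
  then show ?thesis
    using assms(1) by (force simp: LP_optimizer_def is_arg_min_def not_less)
qed

text \<open>
  Every node loses a quadratic amount of profit when it leaves its supplied quantity at price
  \<open>b $ i\<close>, and the total payment \<open>b \<bullet> Q\<close> is at least \<open>b \<bullet> P\<close>. The loss of profit therefore shows up
  as additional cost, which yields optimality and uniqueness at once.
\<close>

lemma supply_dispatch_gap:
  assumes s: "\<And>i. supply_function (C i) (\<mu> i) (s i)"
    and quantity: "\<And>i. P $ i = s i (b $ i)"
    and LP: "LP_optimizer Pd b P" and Q: "feasible_dispatch Pd Q"
  shows "total_cost C P + (\<Sum>i\<in>UNIV. \<mu> i / 2 * (Q $ i - P $ i)\<^sup>2) \<le> total_cost C Q"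
proof -
  have "b $ i * Q $ i - C i (Q $ i) + \<mu> i / 2 * (Q $ i - P $ i)\<^sup>2 \<le> b $ i * P $ i - C i (P $ i)"
    for i
    using supply_functionD(4)[OF s] Q
    by (simp add: quantity feasible_dispatch_def less_eq_vec_def)
  then have "(\<Sum>i\<in>UNIV. b $ i * Q $ i - C i (Q $ i) + \<mu> i / 2 * (Q $ i - P $ i)\<^sup>2) \<le>
      (\<Sum>i\<in>UNIV. b $ i * P $ i - C i (P $ i))"
    by (rule sum_mono)
  then have "b \<bullet> Q - total_cost C Q + (\<Sum>i\<in>UNIV. \<mu> i / 2 * (Q $ i - P $ i)\<^sup>2) \<le>
      b \<bullet> P - total_cost C P"
    by (simp add: sum.distrib sum_subtractf inner_vec_def total_cost_def)
  moreover have "b \<bullet> P \<le> b \<bullet> Q"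
    using LP Q by (auto simp: LP_optimizer_def is_arg_min_def not_less)
  ultimately show ?thesis
    by linarith
qed

lemma supply_dispatch_optimizer:
  assumes s: "\<And>i. supply_function (C i) (\<mu> i) (s i)"
    and quantity: "\<And>i. P $ i = s i (b $ i)" and LP: "LP_optimizer Pd b P"
  shows "dispatch_optimizer C Pd Q \<longleftrightarrow> Q = P"
proof -
  have \<mu>: "0 < \<mu> i" for i
    using supply_functionD(1)[OF s] .
  have P: "feasible_dispatch Pd P"
    using LP by (simp add: LP_optimizer_def is_arg_min_def)
  note gap = supply_dispatch_gap[where Pd = Pd, OF s quantity LP]
  show ?thesis
  proof
    assume "dispatch_optimizer C Pd Q"
    then have Q: "feasible_dispatch Pd Q" "total_cost C Q \<le> total_cost C P"
      using P by (auto simp: dispatch_optimizer_def is_arg_min_def not_less)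
    have nonneg: "0 \<le> \<mu> i / 2 * (Q $ i - P $ i)\<^sup>2" for i
      using \<mu>[of i] by simp
    have "(\<Sum>i\<in>UNIV. \<mu> i / 2 * (Q $ i - P $ i)\<^sup>2) = 0"
      using gap[OF Q(1)] Q(2) sum_nonneg[of UNIV "\<lambda>i. \<mu> i / 2 * (Q $ i - P $ i)\<^sup>2"] nonneg
      by fastforce
    then have "\<mu> i / 2 * (Q $ i - P $ i)\<^sup>2 = 0" for i
      using nonneg by (simp add: sum_nonneg_eq_0_iff)
    then show "Q = P"
      using \<mu> by (simp add: vec_eq_iff less_imp_neq[symmetric])
  next
    assume "Q = P"
    moreover have "total_cost C P \<le> total_cost C R" if "feasible_dispatch Pd R" for R
    proof -
      have "0 \<le> (\<Sum>i\<in>UNIV. \<mu> i / 2 * (R $ i - P $ i)\<^sup>2)"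
        using \<mu> by (intro sum_nonneg) (simp add: less_imp_le)
      then show ?thesis
        using gap[OF that] by linarith
    qed
    ultimately show "dispatch_optimizer C Pd Q"
      using P by (force simp: dispatch_optimizer_def is_arg_min_def not_less)
  qed
qed

lemma market_price_nash_equilibrium:
  assumes s: "\<And>i. supply_function (C i) (\<mu> i) (s i)"
    and quantity: "\<And>i. P $ i = s i (b $ i)" and LP: "LP_optimizer Pd b P" and "0 \<le> b"
    and price: "\<And>i. l \<le> b $ i"
    and rival: "\<And>i. \<exists>j. j \<noteq> i \<and> b $ j = l"
  shows "nash_equilibrium C Pd b"
proof -
  have "payoff (C i) \<beta> (Q $ i) \<le> payoff (C i) (b $ i) (P $ i)"
    if Q: "LP_optimizer Pd (deviate b i \<beta>) Q" for i \<beta> Q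
  proof -
    have "0 \<le> Q $ i"
      using Q by (simp add: LP_optimizer_def is_arg_min_def feasible_dispatch_def less_eq_vec_def)
    have "Q $ i * \<beta> \<le> Q $ i * b $ i"
    proof (cases "l < \<beta>")
      case True
      obtain j where "j \<noteq> i" "b $ j = l"
        using rival by blast
      then have "Q $ i = 0"
        using LP_optimizer_undercut[OF Q, of j i] True by (simp add: deviate_def)
      then show ?thesis by simp
    next
      case False
      then show ?thesis
        using price[of i] \<open>0 \<le> Q $ i\<close> by (intro mult_left_mono) auto
    qed
    then show ?thesis
      using supply_function_maximal[OF s[of i] \<open>0 \<le> Q $ i\<close>, of "b $ i"]
      by (simp add: payoff_def quantity mult.commute)
  qed
  then show ?thesis
    using \<open>0 \<le> b\<close> LP unfolding nash_equilibrium_def by blast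
qed

section \<open>Equilibria of the closed loop\<close>

theorem propositionV2:
  fixes G :: "('n::finite, 'm::finite) pre_digraph"
    and T :: "('n, 't::finite) pre_digraph"
    and D :: "real ^ 'm ^ 'n" and Dt :: "real ^ 't ^ 'n"
    and B :: "real ^ 'n ^ 'n" and V :: "real ^ 'n"
    and \<gamma> :: "real ^ 'm" and \<Gamma> :: "real ^ 'm ^ 'm"
    and M A \<tau>b \<tau>g :: "real ^ 'n ^ 'n" and \<rho> \<sigma> \<tau>l :: real
    and C :: "'n \<Rightarrow> real \<Rightarrow> real" and Pd Pstar :: "real ^ 'n"
    and \<phi> :: "real ^ 't" and \<omega> b Pg :: "real ^ 'n" and l :: real
  assumes network: "oriented_graph G" "Digraph_Component.connected G" "D = incidence_matrix G"
    and weights: "\<And>k. B $ head G k $ tail G k = B $ tail G k $ head G k"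
      "\<And>k. 0 < B $ head G k $ tail G k" "\<And>i. 0 < V $ i"
      "\<And>k. \<gamma> $ k = B $ head G k $ tail G k * V $ head G k * V $ tail G k"
      "\<Gamma> = diag_matrix \<gamma>"
    and tree: "CARD('t) = CARD('n) - 1" "undirected_tree T" "Dt = incidence_matrix T"
    and swing: "pos_diagonal M" "pos_diagonal A"
    and design: "0 < \<rho>" "0 < \<sigma>" "0 < \<tau>l" "pos_diagonal \<tau>b" "pos_diagonal \<tau>g"
    and costs: "\<And>i. cost_function (C i)"
    and load: "0 \<le> Pd" "0 < 1 \<bullet> Pd"
    and dispatch: "dispatch_optimizer C Pd Pstar"
    and two_producers: "\<exists>i j. i \<noteq> j \<and> 0 < Pstar $ i \<and> 0 < Pstar $ j"
    and security: "\<exists>\<phi>0 \<omega>0. swing_system D \<Gamma> Dt M A Pd Pstar \<phi>0 \<omega>0 0 0 \<and>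
      (\<forall>k. angle_differences D Dt \<phi>0 $ k \<in> {- pi / 2 <..< pi / 2})"
    and equilibrium: "closed_loop_equilibrium D \<Gamma> Dt M A Pd C \<rho> \<sigma> \<tau>b \<tau>g \<tau>l \<phi> \<omega> b Pg l"
  shows "\<omega> = 0 \<and> efficient_nash_equilibrium C Pd Pstar b \<and> dispatch_optimizer C Pd Pg"
proof -
  have b0: "0 \<le> b" and Pg0: "0 \<le> Pg"
    and swing_eq: "swing_system D \<Gamma> Dt M A Pd Pg \<phi> \<omega> 0 0"
    and bid_eq: "proj_pos_vec (Pg - gradient_on {x. 0 \<le> x} (total_conjugate C) b) b = 0"
    and gen_eq:
      "proj_pos_vec (l *\<^sub>R 1 - b + (\<rho> * (1 \<bullet> (Pd - Pg))) *\<^sub>R 1 - \<sigma>\<^sup>2 *\<^sub>R \<omega>) Pg = 0"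
    and balance: "1 \<bullet> (Pd - Pg) = 0"
    using equilibrium by (auto simp: closed_loop_equilibrium_def closed_loop_system_def)
  have feasible: "feasible_dispatch Pd Pg"
    using balance Pg0 by (simp add: feasible_dispatch_def inner_diff_right)
  have \<omega>: "\<omega> = 0"
    using balanced_swing_equilibrium[of T A Pg Pd] tree swing swing_eq feasible
    by (simp add: undirected_tree_def feasible_dispatch_def)

  have "\<exists>\<mu> s. supply_function (C i) \<mu> s" for i
    using cost_function_supply[OF costs] by blast
  then obtain \<mu> s where s: "\<And>i. supply_function (C i) (\<mu> i) (s i)"
    by metis
  have quantity: "Pg $ i = s i (b $ i)" for i
  proof -
    have "proj_pos (Pg $ i - s i (b $ i)) (b $ i) = 0"
      using bid_eq by (simp add: gradient_total_conjugate[OF s b0] proj_pos_vec_def vec_eq_iff)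
    moreover have "0 \<le> Pg $ i" "0 \<le> b $ i"
      using Pg0 b0 by (simp_all add: less_eq_vec_def)
    ultimately show ?thesis
      using supply_functionD(2)[OF s, of i]
      by (cases "b $ i = 0") (auto simp: proj_pos_def max_def split: if_splits)
  qed

  have gen: "proj_pos (l - b $ i) (Pg $ i) = 0" for i
    using gen_eq by (simp add: balance \<omega> proj_pos_vec_def vec_eq_iff)
  have price: "l \<le> b $ i" "0 < Pg $ i \<Longrightarrow> b $ i = l" for i
    using gen[of i] by (auto simp: proj_pos_def max_def split: if_splits)
  have LP: "LP_optimizer Pd b Pg"
    using feasible price by (rule LP_optimizer_market_price)
  note optimizer = supply_dispatch_optimizer[OF s quantity LP]
  have Pstar: "Pstar = Pg"
    using dispatch optimizer by simp

  have efficient: "efficient_bid C Pd Pstar b"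
    using b0 LP supply_argmax[OF s] by (simp add: efficient_bid_def Pstar quantity)
  have rival: "\<exists>j. j \<noteq> i \<and> b $ j = l" for i
    using two_producers price(2) unfolding Pstar by metis
  have "nash_equilibrium C Pd b"
    using s quantity LP b0 price(1) rival by (rule market_price_nash_equilibrium)
  with \<omega> efficient optimizer show ?thesis
    by (simp add: efficient_nash_equilibrium_def)
qed

end
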